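(* (Focal Reflection Property.) Suppose that an arc of a given trajectory of the Boltzmann system contains the point $\mathcal F(0,2)$. Then all arcs of that trajectory will also contain the point $\mathcal F$. Furthermore, the trajectory asymptotically converges to the vertical axis $x_1=0$.
   Context: The Boltzmann system: a particle moves in the plane with coordinates $(x_1,x_2)$ in the gravitational field (Kepler problem, inverse square central force) with centre of gravity at the origin $\mathcal O(0,0)$, with the wall $x_2=1$ lying between the particle and the centre of gravity. The particle is reflected absolutely elastically off the wall: the kinetic energy is unchanged and the angles of incidence and reflection are congruent. An arc of a trajectory is the part between consecutive reflections; it lies on a Kepler conic with one focus at the origin. The point $\mathcal F(0,2)$ is symmetric to the centre of gravity with respect to the wall.
   Formalization: Convergence to the axis is claimed only for trajectories with infinitely many future reflections; otherwise it fails: at zero energy, the arc of the parabola with focus at the origin and apex F is followed, after one reflection, by escape to infinity with x_1 unbounded. *)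

theory Defs
  imports "HOL-Analysis.Analysis"
begin

text \<open>
  The plane is \<^typ>\<open>real \<times> real\<close> with coordinates \<open>x\<^sub>1 = fst\<close>, \<open>x\<^sub>2 = snd\<close>.  A trajectory is given by
  the position \<open>q\<close> and the velocity \<open>v\<close> as functions of time; the particle has unit mass and
  \<open>\<mu>\<close> is the strength of the attracting centre at the origin.
\<close>

definition focal_point :: "real \<times> real" where
  "focal_point = (0, 2)"

definition reflection_times :: "(real \<Rightarrow> real \<times> real) \<Rightarrow> real set" where
  "reflection_times q = {t. snd (q t) = 1}"

text \<open>
  The wall is horizontal, so equal kinetic energy together with equal angles of incidence and
  reflection means that the vertical component of the velocity changes its sign and the
  horizontal one is kept.
\<close>

definition reflect_velocity :: "real \<times> real \<Rightarrow> real \<times> real" where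
  "reflect_velocity w = (fst w, - snd w)"

text \<open>
  The velocity jumps at a reflection, so there only its one-sided limits are constrained; the value
  of \<open>v\<close> at a reflection time is irrelevant.  Local finiteness of the reflection times makes
  consecutive reflections meaningful and excludes sliding along the wall.  Motions with only
  finitely many reflections (which escape to infinity) are included.
\<close>

definition boltzmann_trajectory ::
    "real \<Rightarrow> (real \<Rightarrow> real \<times> real) \<Rightarrow> (real \<Rightarrow> real \<times> real) \<Rightarrow> bool" where
  "boltzmann_trajectory \<mu> q v \<longleftrightarrow>
     continuous_on UNIV q \<and>
     (\<forall>t. snd (q t) \<ge> 1) \<and>
     (\<forall>a b. finite (reflection_times q \<inter> {a..b})) \<and>
     (\<forall>t. t \<notin> reflection_times q \<longrightarrow>
        (q has_vector_derivative v t) (at t) \<and>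
        (v has_vector_derivative - (\<mu> / norm (q t) ^ 3) *\<^sub>R q t) (at t)) \<and>
     (\<forall>t \<in> reflection_times q. \<exists>w.
        (v \<longlongrightarrow> w) (at_left t) \<and> (v \<longlongrightarrow> reflect_velocity w) (at_right t))"

definition is_arc :: "(real \<Rightarrow> real \<times> real) \<Rightarrow> (real \<times> real) set \<Rightarrow> bool" where
  "is_arc q A \<longleftrightarrow>
     (\<exists>s t. s < t \<and> s \<in> reflection_times q \<and> t \<in> reflection_times q \<and>
        reflection_times q \<inter> {s<..<t} = {} \<and> A = q ` {s..t})"

text \<open>
  Infinitely many reflections in the future.  By local finiteness this is the same as reflection
  times that are unbounded above.
\<close>

definition reflects_forever :: "(real \<Rightarrow> real \<times> real) \<Rightarrow> bool" where
  "reflects_forever q \<longleftrightarrow> infinite (reflection_times q \<inter> {0..})"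

definition converges_to_vertical_axis :: "(real \<Rightarrow> real \<times> real) \<Rightarrow> bool" where
  "converges_to_vertical_axis q \<longleftrightarrow> ((\<lambda>t. fst (q t)) \<longlongrightarrow> 0) at_top"

end

theory Submission
  imports Defs
begin

text \<open>
  Between two reflections the angular momentum \<open>L\<close>, the energy \<open>E\<close> and the Laplace-Runge-Lenz vector
  \<open>(A, A')\<close> are constant, and the orbit satisfies \<open>L\<^sup>2 = \<mu> |q| + A x\<^sub>1 + A' x\<^sub>2\<close>.  A reflection keeps \<open>E\<close>
  and changes both \<open>L\<^sup>2\<close> and \<open>2 A'\<close> by the same amount, so \<open>D = L\<^sup>2 - 2 A'\<close> is a second integral of the
  whole system, found by Gallavotti and Jauslin.  Evaluating it at \<open>(0, 2)\<close> gives \<open>D = 2\<mu>\<close>, whatever the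
  velocity is; so one arc through the focal point forces \<open>D = 2\<mu>\<close> forever.

  Conversely, let \<open>D = 2\<mu>\<close>.  If \<open>L \<noteq> 0\<close>, the endpoints of an arc are two different zeros of
  \<open>x \<mapsto> \<mu> |(x, 1)| + A x - (L\<^sup>2 / 2 + \<mu>)\<close>, a convex function that is negative at 0, so they lie on opposite
  sides of the vertical axis (\<open>wall_points_opposite\<close>).  The arc therefore crosses the axis, and the
  orbit equation puts the crossing at height 2.  If \<open>L = 0\<close>, the motion stays on the axis, and all arcs rise
  to the same height because they have the same energy.

  For the asymptotics, let \<open>(a, b)\<close> be the velocity with which an orbit passes the focal point.  Its
  length \<open>c\<close> is determined by the energy, so the orbit is described by a point on a circle, on which a reflection acts
  as a fractional linear map with the two vertical directions as fixed points.  In the coordinate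
  \<open>(c + b) / a\<close>, which puts these fixed points at 0 and infinity, the map is multiplication by
  \<open>- (k - c) / (k + c)\<close>, where \<open>k\<^sup>2 = c\<^sup>2 + \<mu>\<close> (\<open>focal_reflect_contraction\<close>).  Infinitely many reflections
  hence force \<open>a\<close>, and with it \<open>L = -2a\<close>, to tend to 0.  A nonnegative energy is incompatible with this,
  since a particle at its highest point would be too fast for so small an angular momentum; a
  negative energy bounds the distance from the centre, and then the orbit equation with small \<open>L\<close>
  confines the particle to the vicinity of the axis.
\<close>

section \<open>First integrals of the Kepler problem\<close>

definition ang_mom :: "real \<times> real \<Rightarrow> real \<times> real \<Rightarrow> real" where
  "ang_mom p w = fst p * snd w - snd p * fst w"

definition energy :: "real \<Rightarrow> real \<times> real \<Rightarrow> real \<times> real \<Rightarrow> real" where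
  "energy \<mu> p w = (norm w)\<^sup>2 / 2 - \<mu> / norm p"

definition lrl_x :: "real \<Rightarrow> real \<times> real \<Rightarrow> real \<times> real \<Rightarrow> real" where
  "lrl_x \<mu> p w = snd w * ang_mom p w - \<mu> * fst p / norm p"

definition lrl_y :: "real \<Rightarrow> real \<times> real \<Rightarrow> real \<times> real \<Rightarrow> real" where
  "lrl_y \<mu> p w = - fst w * ang_mom p w - \<mu> * snd p / norm p"

text \<open>
  The first integral of Gallavotti and Jauslin.
\<close>

definition gj_integral :: "real \<Rightarrow> real \<times> real \<Rightarrow> real \<times> real \<Rightarrow> real" where
  "gj_integral \<mu> p w = (ang_mom p w)\<^sup>2 - 2 * lrl_y \<mu> p w"

lemma norm_sq_real_prod: "(norm p)\<^sup>2 = (fst p)\<^sup>2 + (snd p)\<^sup>2" for p :: "real \<times> real"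
  by (simp add: norm_prod_def)

lemma orbit_equation:
  assumes "p \<noteq> 0"
  shows "(ang_mom p w)\<^sup>2 = \<mu> * norm p + lrl_x \<mu> p w * fst p + lrl_y \<mu> p w * snd p"
proof -
  define m where "m = \<mu> / norm p"
  have "\<mu> * norm p = m * (norm p)\<^sup>2"
    using assms by (simp add: m_def power2_eq_square)
  then have m: "\<mu> * norm p = m * ((fst p)\<^sup>2 + (snd p)\<^sup>2)" by (simp only: norm_sq_real_prod)
  have A: "lrl_x \<mu> p w = snd w * ang_mom p w - m * fst p"
    "lrl_y \<mu> p w = - fst w * ang_mom p w - m * snd p"
    by (simp_all add: lrl_x_def lrl_y_def m_def)
  show ?thesis
    unfolding A m by (simp add: ang_mom_def algebra_simps power2_eq_square)
qed

lemma lrl_norm: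
  assumes "p \<noteq> 0"
  shows "(lrl_x \<mu> p w)\<^sup>2 + (lrl_y \<mu> p w)\<^sup>2 = \<mu>\<^sup>2 + 2 * energy \<mu> p w * (ang_mom p w)\<^sup>2"
proof -
  define m where "m = \<mu> / norm p"
  have "\<mu>\<^sup>2 = m\<^sup>2 * (norm p)\<^sup>2"
    using assms by (simp add: m_def power2_eq_square)
  then have m: "\<mu>\<^sup>2 = m\<^sup>2 * ((fst p)\<^sup>2 + (snd p)\<^sup>2)" by (simp only: norm_sq_real_prod)
  have A: "lrl_x \<mu> p w = snd w * ang_mom p w - m * fst p"
    "lrl_y \<mu> p w = - fst w * ang_mom p w - m * snd p"
    by (simp_all add: lrl_x_def lrl_y_def m_def)
  have E: "2 * energy \<mu> p w = (fst w)\<^sup>2 + (snd w)\<^sup>2 - 2 * m"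
    by (simp add: energy_def norm_sq_real_prod m_def)
  show ?thesis
    unfolding A m E by (simp add: ang_mom_def algebra_simps power2_eq_square)
qed

text \<open>
  In terms of the velocity \<open>(a, b)\<close> at \<open>(0, 2)\<close>, where \<open>ang_mom = -2a\<close> and \<open>lrl_x = b ang_mom\<close>, this is the
  energy relation \<open>a\<^sup>2 + b\<^sup>2 = 2E + \<mu>\<close> multiplied by \<open>ang_mom\<^sup>2\<close>.
\<close>

lemma lrl_x_focal:
  assumes "p \<noteq> 0" "gj_integral \<mu> p w = 2 * \<mu>"
  shows "(lrl_x \<mu> p w)\<^sup>2
    = (2 * energy \<mu> p w + \<mu>) * (ang_mom p w)\<^sup>2 - ((ang_mom p w)\<^sup>2)\<^sup>2 / 4"
proof -
  have y: "lrl_y \<mu> p w = (ang_mom p w)\<^sup>2 / 2 - \<mu>" using assms(2) by (simp add: gj_integral_def)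
  show ?thesis using lrl_norm[OF assms(1), of \<mu> w] unfolding y
    by (simp add: power2_eq_square algebra_simps)
qed

lemma kepler_conserved:
  fixes q v :: "real \<Rightarrow> real \<times> real"
  assumes q: "(q has_vector_derivative v t) (at t)"
    and v: "(v has_vector_derivative - (\<mu> / norm (q t) ^ 3) *\<^sub>R q t) (at t)"
    and "q t \<noteq> 0"
  shows "((\<lambda>t. ang_mom (q t) (v t)) has_real_derivative 0) (at t)"
    and "((\<lambda>t. energy \<mu> (q t) (v t)) has_real_derivative 0) (at t)"
    and "((\<lambda>t. lrl_x \<mu> (q t) (v t)) has_real_derivative 0) (at t)"
    and "((\<lambda>t. lrl_y \<mu> (q t) (v t)) has_real_derivative 0) (at t)"
proof -
  define r where "r = norm (q t)"
  have r: "r > 0" "r\<^sup>2 = (fst (q t))\<^sup>2 + (snd (q t))\<^sup>2"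
    using assms(3) by (simp_all add: r_def norm_sq_real_prod)
  have X: "((\<lambda>t. fst (q t)) has_real_derivative fst (v t)) (at t)"
    using bounded_linear.has_vector_derivative[OF bounded_linear_fst q]
    by (simp add: has_real_derivative_iff_has_vector_derivative)
  have Y: "((\<lambda>t. snd (q t)) has_real_derivative snd (v t)) (at t)"
    using bounded_linear.has_vector_derivative[OF bounded_linear_snd q]
    by (simp add: has_real_derivative_iff_has_vector_derivative)
  have V: "((\<lambda>t. fst (v t)) has_real_derivative - (\<mu> / r ^ 3) * fst (q t)) (at t)"
    using bounded_linear.has_vector_derivative[OF bounded_linear_fst v]
    by (simp add: has_real_derivative_iff_has_vector_derivative r_def)
  have W: "((\<lambda>t. snd (v t)) has_real_derivative - (\<mu> / r ^ 3) * snd (q t)) (at t)"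
    using bounded_linear.has_vector_derivative[OF bounded_linear_snd v]
    by (simp add: has_real_derivative_iff_has_vector_derivative r_def)
  have R: "((\<lambda>t. norm (q t)) has_real_derivative
      (fst (q t) * fst (v t) + snd (q t) * snd (v t)) / r) (at t)"
  proof -
    have pos: "0 < (fst (q t))\<^sup>2 + (snd (q t))\<^sup>2" using r by (metis zero_less_power)
    have "sqrt ((fst (q t))\<^sup>2 + (snd (q t))\<^sup>2) = r" using r by (metis abs_of_pos real_sqrt_abs)
    then show ?thesis
      unfolding norm_prod_def real_norm_def power2_abs
      using pos by (auto intro!: derivative_eq_intros X Y simp: divide_simps algebra_simps)
  qed
  have L: "((\<lambda>t. ang_mom (q t) (v t)) has_real_derivative 0) (at t)"
    unfolding ang_mom_def by (auto intro!: derivative_eq_intros X Y V W)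
  then show "((\<lambda>t. ang_mom (q t) (v t)) has_real_derivative 0) (at t)" .
  define g where "g = \<mu> / r ^ 3"
  have M: "((\<lambda>t. \<mu> / norm (q t)) has_real_derivative
      - g * (fst (q t) * fst (v t) + snd (q t) * snd (v t))) (at t)"
    using assms(3) r(1) by (auto intro!: derivative_eq_intros R
        simp: g_def r_def[symmetric] field_simps power3_eq_cube)
  \<comment> \<open>turns the derivatives of the two components into polynomial identities\<close>
  have g: "\<mu> / norm (q t) = g * ((fst (q t))\<^sup>2 + (snd (q t))\<^sup>2)"
    using r(1) unfolding r(2)[symmetric] r_def[symmetric] g_def
    by (simp add: power2_eq_square power3_eq_cube)
  note D = V[folded g_def] W[folded g_def]
  have "((\<lambda>t. ((fst (v t))\<^sup>2 + (snd (v t))\<^sup>2) / 2) has_real_derivative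
      - g * (fst (q t) * fst (v t) + snd (q t) * snd (v t))) (at t)"
    by (auto intro!: derivative_eq_intros D simp: field_simps)
  from DERIV_diff[OF this M] show "((\<lambda>t. energy \<mu> (q t) (v t)) has_real_derivative 0) (at t)"
    by (simp add: energy_def norm_sq_real_prod)
  have A: "lrl_x \<mu> p w = snd w * ang_mom p w - \<mu> / norm p * fst p"
    "lrl_y \<mu> p w = - fst w * ang_mom p w - \<mu> / norm p * snd p" for p w
    by (simp_all add: lrl_x_def lrl_y_def)
  show "((\<lambda>t. lrl_x \<mu> (q t) (v t)) has_real_derivative 0) (at t)"
    unfolding A
    by (rule DERIV_cong[OF DERIV_diff[OF DERIV_mult[OF D(2) L] DERIV_mult[OF M X]]],
        unfold g ang_mom_def, simp add: algebra_simps power2_eq_square)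
  show "((\<lambda>t. lrl_y \<mu> (q t) (v t)) has_real_derivative 0) (at t)"
    unfolding A
    by (rule DERIV_cong[OF DERIV_diff[OF DERIV_mult[OF DERIV_minus[OF D(1)] L] DERIV_mult[OF M Y]]],
        unfold g ang_mom_def, simp add: algebra_simps power2_eq_square)
qed

section \<open>Reflection at the wall\<close>

text \<open>
  At a point \<open>(x, 1)\<close> the velocities \<open>(a, b)\<close> and \<open>(a, -b)\<close> give angular momenta \<open>x b - a\<close> and
  \<open>- x b - a\<close>; both \<open>ang_mom\<^sup>2\<close> and \<open>2 lrl_y\<close> then change by \<open>4 x a b\<close>.
\<close>

lemma gj_integral_reflect:
  assumes "snd p = 1"
  shows "gj_integral \<mu> p (reflect_velocity w) = gj_integral \<mu> p w"
  using assms by (simp add: gj_integral_def lrl_y_def ang_mom_def reflect_velocity_def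
      power2_eq_square algebra_simps)

lemma energy_reflect: "energy \<mu> p (reflect_velocity w) = energy \<mu> p w"
  by (simp add: energy_def norm_sq_real_prod reflect_velocity_def)

text \<open>
  Both parts are the relation \<open>x\<^sup>2 b\<^sup>2 - a\<^sup>2 = 2\<mu> (1 - 1/r)\<close> in disguise, which is what the value \<open>2\<mu>\<close> of the
  Gallavotti-Jauslin integral means at \<open>(x, 1)\<close> for the velocity \<open>(a, b)\<close>.  The second part says that
  all reflections of such a trajectory share the value of \<open>r |b|\<close>.
\<close>

lemma focal_at_wall:
  assumes "snd p = 1" "gj_integral \<mu> p w = 2 * \<mu>"
  shows "ang_mom p w * ang_mom p (reflect_velocity w) = - 2 * \<mu> * (1 - 1 / norm p)"
    and "2 * energy \<mu> p w + 2 * \<mu> = (norm p * snd w)\<^sup>2"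
proof -
  define r where "r = norm p"
  have r: "r\<^sup>2 = (fst p)\<^sup>2 + 1" using assms by (simp add: r_def norm_sq_real_prod)
  have D: "(fst p)\<^sup>2 * (snd w)\<^sup>2 - (fst w)\<^sup>2 = 2 * \<mu> * (1 - 1 / r)"
    using assms by (simp add: gj_integral_def lrl_y_def ang_mom_def r_def
        power2_eq_square algebra_simps)
  then show "ang_mom p w * ang_mom p (reflect_velocity w) = - 2 * \<mu> * (1 - 1 / norm p)"
    using assms(1) by (simp add: ang_mom_def reflect_velocity_def r_def
        power2_eq_square algebra_simps)
  show "2 * energy \<mu> p w + 2 * \<mu> = (norm p * snd w)\<^sup>2"
    unfolding energy_def norm_sq_real_prod power_mult_distrib r_def[symmetric] r
    using D by (simp add: algebra_simps)
qed

lemma focal_reflect_ang_mom_zero: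
  assumes "\<mu> > 0" "snd p = 1" "gj_integral \<mu> p w = 2 * \<mu>"
  shows "ang_mom p (reflect_velocity w) = 0 \<longleftrightarrow> ang_mom p w = 0"
proof -
  have nz: "norm p \<noteq> 0" using assms(2) by auto
  have "fst p = 0" if "ang_mom p w * ang_mom p (reflect_velocity w) = 0"
  proof -
    have "norm p = 1" using that focal_at_wall(1)[OF assms(2,3)] assms(1) nz by simp
    then show ?thesis using norm_sq_real_prod[of p] assms(2) by simp
  qed
  then show ?thesis by (auto simp: ang_mom_def reflect_velocity_def)
qed

text \<open>
  The quotient \<open>(c ang_mom + lrl_x) / ang_mom\<^sup>2\<close> equals \<open>- (c + b) / (2a)\<close>, where \<open>(a, b)\<close> is the velocity of
  the orbit at \<open>(0, 2)\<close> and \<open>|c|\<close> its length.  For \<open>c > 0\<close> it is, up to the factor \<open>- 1/2\<close>, the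
  cotangent of half the angle between that velocity and the upward vertical.  A downward velocity at
  the wall means \<open>k = - norm p * snd w\<close>, and thereby selects the attracting one of the two vertical directions: with \<open>snd w \<ge> 0\<close>
  the roles of \<open>k - c\<close> and \<open>k + c\<close> would be exchanged.
\<close>

lemma focal_reflect_contraction:
  fixes \<mu> c k :: real
  assumes mu: "\<mu> > 0" and wall: "snd p = 1" and D: "gj_integral \<mu> p w = 2 * \<mu>"
    and down: "snd w \<le> 0" and L0: "ang_mom p w \<noteq> 0"
    and c: "c\<^sup>2 = 2 * energy \<mu> p w + \<mu>" and k: "k\<^sup>2 = 2 * energy \<mu> p w + 2 * \<mu>" "k \<ge> 0"
  shows "(k + c) * ((c * ang_mom p (reflect_velocity w) + lrl_x \<mu> p (reflect_velocity w))
            / (ang_mom p (reflect_velocity w))\<^sup>2)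
       = - (k - c) * ((c * ang_mom p w + lrl_x \<mu> p w) / (ang_mom p w)\<^sup>2)"
proof -
  define r x y V where "r = norm p" and "x = fst p" and "y = - snd w" and "V = fst w"
  define L where "L = ang_mom p w"
  define L' where "L' = ang_mom p (reflect_velocity w)"
  have L: "L = - x * y - V" "L' = x * y - V"
    using wall by (simp_all add: L_def L'_def ang_mom_def reflect_velocity_def x_def y_def V_def)
  have nz: "L \<noteq> 0" "L' \<noteq> 0"
    using L0 focal_reflect_ang_mom_zero[OF mu wall D] by (simp_all add: L_def L'_def)
  have r: "r\<^sup>2 = x\<^sup>2 + 1" "r > 0" using wall
    by (auto simp: r_def x_def norm_sq_real_prod)
  have k': "k = r * y"
  proof -
    have "k\<^sup>2 = (r * y)\<^sup>2" using k(1) focal_at_wall(2)[OF wall D] by (simp add: r_def y_def)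
    moreover have "r * y \<ge> 0" using r(2) down by (simp add: y_def mult_nonneg_nonpos)
    ultimately show ?thesis using k(2) power2_eq_iff_nonneg by blast
  qed
  have LL: "L * L' * r = - 2 * \<mu> * (r - 1)"
    using focal_at_wall(1)[OF wall D] r(2)
    by (simp add: L_def L'_def r_def[symmetric] field_simps)
  have r1: "r \<noteq> 1" using LL nz r(2) by auto
  then have x0: "x \<noteq> 0" using r by (auto simp: power2_eq_1_iff)
  have A: "lrl_x \<mu> p w * r = - y * L * r - \<mu> * x"
       "lrl_x \<mu> p (reflect_velocity w) * r = y * L' * r - \<mu> * x"
    using r(2) by (simp_all add: lrl_x_def L_def L'_def reflect_velocity_def y_def x_def
        r_def[symmetric] field_simps)
  \<comment> \<open>\<open>\<mu> / r\<close> is eliminated in favour of \<open>L * L'\<close>, using \<open>x\<^sup>2 = (r - 1) * (r + 1)\<close>\<close>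
  have B: "2 * x * lrl_x \<mu> p w = - 2 * x * y * L + (r + 1) * (L * L')"
       "2 * x * lrl_x \<mu> p (reflect_velocity w) = 2 * x * y * L' + (r + 1) * (L * L')"
  proof -
    have "r * (r - 1) * (2 * x * lrl_x \<mu> p w)
        = r * (r - 1) * (- 2 * x * y * L + (r + 1) * (L * L'))"
      using A(1) LL r(1) by algebra
    then show "2 * x * lrl_x \<mu> p w = - 2 * x * y * L + (r + 1) * (L * L')"
      using r(2) r1 by simp
    have "r * (r - 1) * (2 * x * lrl_x \<mu> p (reflect_velocity w))
        = r * (r - 1) * (2 * x * y * L' + (r + 1) * (L * L'))"
      using A(2) LL r(1) by algebra
    then show "2 * x * lrl_x \<mu> p (reflect_velocity w) = 2 * x * y * L' + (r + 1) * (L * L')"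
      using r(2) r1 by simp
  qed
  have ck: "c\<^sup>2 = k\<^sup>2 - \<mu>" using c k by simp
  have key: "(k + c) * (2 * x * c * L + 2 * x * y * L + (r + 1) * L\<^sup>2)
      = - (k - c) * (2 * x * c * L' - 2 * x * y * L' + (r + 1) * L'\<^sup>2)"
    using ck LL r(1) unfolding k' L by algebra
  \<comment> \<open>the old quotient is thus expressed by the new angular momentum and vice versa, with the
     common denominator \<open>2 * x * L * L'\<close>\<close>
  have P: "2 * x * L * (c * L' + lrl_x \<mu> p (reflect_velocity w))
      = L' * (2 * x * c * L + 2 * x * y * L + (r + 1) * L\<^sup>2)"
    using B(2) by algebra
  have Q: "2 * x * L' * (c * L + lrl_x \<mu> p w)
      = L * (2 * x * c * L' - 2 * x * y * L' + (r + 1) * L'\<^sup>2)"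
    using B(1) by algebra
  have P': "(c * L' + lrl_x \<mu> p (reflect_velocity w)) / L'\<^sup>2
      = (2 * x * c * L + 2 * x * y * L + (r + 1) * L\<^sup>2) / (2 * x * L * L')"
    using P nz x0 by (simp add: frac_eq_eq power2_eq_square) algebra
  have Q': "(c * L + lrl_x \<mu> p w) / L\<^sup>2
      = (2 * x * c * L' - 2 * x * y * L' + (r + 1) * L'\<^sup>2) / (2 * x * L * L')"
    using Q nz x0 by (simp add: frac_eq_eq power2_eq_square) algebra
  show ?thesis
    unfolding L_def[symmetric] L'_def[symmetric] P' Q' times_divide_eq_right key ..
qed


text \<open>
  The function \<open>x \<mapsto> \<mu> |(x, 1)| + A x - B\<close> is convex and negative at 0.  Were two zeros on the same side
  of 0, the nearer one would be a proper convex combination of the other and 0, and the function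
  would be negative there.
\<close>

lemma wall_points_opposite:
  fixes A B \<mu> x y :: real
  assumes mu: "\<mu> > 0" and B: "B > \<mu>" and ne: "x \<noteq> y"
    and x: "\<mu> * norm (x, 1::real) + A * x = B" and y: "\<mu> * norm (y, 1::real) + A * y = B"
  shows "x * y < 0"
proof (rule ccontr)
  have False if h: "0 < a * b" "\<bar>a\<bar> < \<bar>b\<bar>"
    and a: "\<mu> * norm (a, 1::real) + A * a = B" and b: "\<mu> * norm (b, 1::real) + A * b = B"
  for a b
  proof -
    define \<theta> where "\<theta> = a / b"
    have \<theta>: "0 < \<theta>" "\<theta> < 1" "a = \<theta> * b" using h
      by (auto simp: \<theta>_def zero_less_mult_iff divide_simps abs_if split: if_splits)
    have "(a, 1::real) = \<theta> *\<^sub>R (b, 1) + (1 - \<theta>) *\<^sub>R (0, 1)" using \<theta> by simp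
    then have "norm (a, 1::real) \<le> norm (\<theta> *\<^sub>R (b, 1::real)) + norm ((1 - \<theta>) *\<^sub>R (0::real, 1::real))"
      by (metis norm_triangle_ineq)
    also have "\<dots> = \<theta> * norm (b, 1::real) + (1 - \<theta>)"
      using \<theta> unfolding norm_scaleR by simp
    finally have "\<mu> * norm (a, 1::real) \<le> \<mu> * (\<theta> * norm (b, 1::real) + (1 - \<theta>))"
      using mu by simp
    moreover have "\<mu> * norm (a, 1::real) = (1 - \<theta>) * B + \<theta> * (\<mu> * norm (b, 1::real))"
      using a b \<theta>(3) by (simp add: b[symmetric] algebra_simps)
    ultimately have "(1 - \<theta>) * B \<le> (1 - \<theta>) * \<mu>" by (simp add: algebra_simps)
    then show False using \<theta>(2) B by simp
  qed
  note nearer = this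
  have nz: "x \<noteq> 0" "y \<noteq> 0" using x y B by auto
  assume "\<not> x * y < 0"
  then have p: "0 < x * y" using nz by (metis linorder_neqE_linordered_idom mult_eq_0_iff)
  then have "\<bar>x\<bar> \<noteq> \<bar>y\<bar>" using ne by (auto simp: abs_if zero_less_mult_iff split: if_splits)
  then show False using nearer[of x y] nearer[of y x] p x y
    by (metis linorder_neqE_linordered_idom mult.commute)
qed

section \<open>Flights and reflections\<close>

locale boltzmann =
  fixes \<mu> :: real and q v :: "real \<Rightarrow> real \<times> real"
  assumes mu_pos: "\<mu> > 0" and traj: "boltzmann_trajectory \<mu> q v"
begin

abbreviation R where "R \<equiv> reflection_times q"

lemma above_wall: "snd (q t) \<ge> 1"
  using traj by (simp add: boltzmann_trajectory_def)

lemma q_nonzero [simp]: "q t \<noteq> 0"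
  using above_wall[of t] by auto

lemma at_wall: "t \<in> R \<Longrightarrow> snd (q t) = 1"
  by (simp add: reflection_times_def)

lemma off_wall: "t \<notin> R \<Longrightarrow> snd (q t) > 1"
  using above_wall[of t] by (simp add: reflection_times_def)

lemma finite_reflections: "finite (R \<inter> {a..b})"
  using traj by (simp add: boltzmann_trajectory_def)

lemma continuous_q: "continuous_on S q"
  using traj continuous_on_subset[of UNIV q S] by (simp add: boltzmann_trajectory_def)

lemma isCont_q: "isCont q t"
  using continuous_q[of UNIV] by (simp add: continuous_on_eq_continuous_at)

lemma motion:
  assumes "t \<notin> R"
  shows "(q has_vector_derivative v t) (at t)"
    "(v has_vector_derivative - (\<mu> / norm (q t) ^ 3) *\<^sub>R q t) (at t)"
  using traj assms by (simp_all add: boltzmann_trajectory_def)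

lemma coordinate_derivs:
  assumes "t \<notin> R"
  shows "((\<lambda>t. fst (q t)) has_real_derivative fst (v t)) (at t)"
    "((\<lambda>t. snd (q t)) has_real_derivative snd (v t)) (at t)"
  using bounded_linear.has_vector_derivative[OF bounded_linear_fst motion(1)[OF assms]]
    bounded_linear.has_vector_derivative[OF bounded_linear_snd motion(1)[OF assms]]
  by (simp_all add: has_real_derivative_iff_has_vector_derivative)

text \<open>
  The second clause lets one-sided limits of the velocity at a reflection be inserted into \<open>\<Phi>\<close>; it is
  stated for arbitrary filters to cover both sides at once.
\<close>

definition flight_integral :: "(real \<times> real \<Rightarrow> real \<times> real \<Rightarrow> real) \<Rightarrow> bool" where
  "flight_integral \<Phi> \<longleftrightarrow>
     (\<forall>t. t \<notin> R \<longrightarrow> ((\<lambda>t. \<Phi> (q t) (v t)) has_real_derivative 0) (at t)) \<and>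
     (\<forall>t w F. F \<le> at t \<longrightarrow> (v \<longlongrightarrow> w) F \<longrightarrow> ((\<lambda>t. \<Phi> (q t) (v t)) \<longlongrightarrow> \<Phi> (q t) w) F)"

lemma flight_integrals:
  "flight_integral ang_mom" "flight_integral (energy \<mu>)"
  "flight_integral (lrl_x \<mu>)" "flight_integral (lrl_y \<mu>)"
proof -
  have q: "(q \<longlongrightarrow> q t) F" if "F \<le> at t" for t F
    using tendsto_mono[OF that] isCont_q[of t] unfolding isCont_def by blast
  note conserved = kepler_conserved[OF motion q_nonzero]
  have limits:
    "((\<lambda>t. ang_mom (q t) (v t)) \<longlongrightarrow> ang_mom (q t) w) F"
    "((\<lambda>t. energy \<mu> (q t) (v t)) \<longlongrightarrow> energy \<mu> (q t) w) F"
    "((\<lambda>t. lrl_x \<mu> (q t) (v t)) \<longlongrightarrow> lrl_x \<mu> (q t) w) F"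
    "((\<lambda>t. lrl_y \<mu> (q t) (v t)) \<longlongrightarrow> lrl_y \<mu> (q t) w) F"
    if F: "F \<le> at t" and w: "(v \<longlongrightarrow> w) F" for t w F
    unfolding ang_mom_def energy_def lrl_x_def lrl_y_def
    by (intro tendsto_intros q[OF F] w; simp)+
  show "flight_integral ang_mom" "flight_integral (energy \<mu>)"
    "flight_integral (lrl_x \<mu>)" "flight_integral (lrl_y \<mu>)"
    unfolding flight_integral_def using conserved limits by blast+
qed

lemma flight_integral_gj: "flight_integral (gj_integral \<mu>)"
  unfolding flight_integral_def gj_integral_def
proof (intro conjI allI impI)
  fix t assume "t \<notin> R"
  then have "((\<lambda>t. ang_mom (q t) (v t)) has_real_derivative 0) (at t)"
     "((\<lambda>t. lrl_y \<mu> (q t) (v t)) has_real_derivative 0) (at t)"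
    using flight_integrals by (auto simp: flight_integral_def)
  then show "((\<lambda>t. (ang_mom (q t) (v t))\<^sup>2 - 2 * lrl_y \<mu> (q t) (v t)) has_real_derivative 0) (at t)"
    by (auto intro!: derivative_eq_intros)
next
  fix t w and F :: "real filter" assume "F \<le> at t" "(v \<longlongrightarrow> w) F"
  then have "((\<lambda>t. ang_mom (q t) (v t)) \<longlongrightarrow> ang_mom (q t) w) F"
     "((\<lambda>t. lrl_y \<mu> (q t) (v t)) \<longlongrightarrow> lrl_y \<mu> (q t) w) F"
    using flight_integrals unfolding flight_integral_def by blast+
  then show "((\<lambda>t. (ang_mom (q t) (v t))\<^sup>2 - 2 * lrl_y \<mu> (q t) (v t))
      \<longlongrightarrow> (ang_mom (q t) w)\<^sup>2 - 2 * lrl_y \<mu> (q t) w) F"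
    by (intro tendsto_intros)
qed

lemma flight_constant:
  assumes "flight_integral \<Phi>" "convex I" "I \<inter> R = {}" "s \<in> I" "t \<in> I"
  shows "\<Phi> (q s) (v s) = \<Phi> (q t) (v t)"
proof -
  have "((\<lambda>t. \<Phi> (q t) (v t)) has_real_derivative 0) (at x within I)" if "x \<in> I" for x
    using assms(1,3) that unfolding flight_integral_def
    by (meson disjoint_iff has_field_derivative_at_within)
  then obtain c where "\<forall>x\<in>I. \<Phi> (q x) (v x) = c"
    using has_field_derivative_zero_constant[OF assms(2), of "\<lambda>t. \<Phi> (q t) (v t)"] by blast
  then show ?thesis using assms(4,5) by simp
qed

text \<open>
  By continuity, the values of a first integral on the two adjacent flights are its values for the
  incoming and the outgoing velocity at the wall.  The incoming velocity cannot point upwards, for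
  the particle would then have come from below the wall.
\<close>

lemma crossing:
  assumes "s < \<rho>" "\<rho> < t" "R \<inter> {s..t} = {\<rho>}"
  obtains w where "snd w \<le> 0"
    and "\<And>\<Phi>. flight_integral \<Phi> \<Longrightarrow> \<Phi> (q s) (v s) = \<Phi> (q \<rho>) w"
    and "\<And>\<Phi>. flight_integral \<Phi> \<Longrightarrow> \<Phi> (q t) (v t) = \<Phi> (q \<rho>) (reflect_velocity w)"
proof -
  have \<rho>: "\<rho> \<in> R" using assms by auto
  have free: "x \<notin> R" if "x \<in> {s..t}" "x \<noteq> \<rho>" for x using assms(3) that by blast
  obtain w where w: "(v \<longlongrightarrow> w) (at_left \<rho>)" "(v \<longlongrightarrow> reflect_velocity w) (at_right \<rho>)"
    using traj \<rho> unfolding boltzmann_trajectory_def by blast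
  have left: "\<Phi> (q s) (v s) = \<Phi> (q \<rho>) w" if \<Phi>: "flight_integral \<Phi>" for \<Phi>
  proof -
    have "\<forall>\<^sub>F x in at_left \<rho>. \<Phi> (q x) (v x) = \<Phi> (q s) (v s)"
      using eventually_at_left_real[OF assms(1)]
    proof eventually_elim
      case (elim x)
      then show ?case using flight_constant[OF \<Phi>, of "{s..<\<rho>}" x s] free assms(1,2) by force
    qed
    then have "((\<lambda>x. \<Phi> (q x) (v x)) \<longlongrightarrow> \<Phi> (q s) (v s)) (at_left \<rho>)"
      by (rule tendsto_eventually)
    moreover have "((\<lambda>x. \<Phi> (q x) (v x)) \<longlongrightarrow> \<Phi> (q \<rho>) w) (at_left \<rho>)"
      using \<Phi> w(1) at_le[of "{..<\<rho>}" UNIV \<rho>] unfolding flight_integral_def by blast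
    ultimately show ?thesis using tendsto_unique trivial_limit_at_left_real by blast
  qed
  have right: "\<Phi> (q t) (v t) = \<Phi> (q \<rho>) (reflect_velocity w)" if \<Phi>: "flight_integral \<Phi>" for \<Phi>
  proof -
    have "\<forall>\<^sub>F x in at_right \<rho>. \<Phi> (q x) (v x) = \<Phi> (q t) (v t)"
      using eventually_at_right_real[OF assms(2)]
    proof eventually_elim
      case (elim x)
      then show ?case using flight_constant[OF \<Phi>, of "{\<rho><..t}" x t] free assms(1,2) by force
    qed
    then have "((\<lambda>x. \<Phi> (q x) (v x)) \<longlongrightarrow> \<Phi> (q t) (v t)) (at_right \<rho>)"
      by (rule tendsto_eventually)
    moreover have "((\<lambda>x. \<Phi> (q x) (v x)) \<longlongrightarrow> \<Phi> (q \<rho>) (reflect_velocity w)) (at_right \<rho>)"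
      using \<Phi> w(2) at_le[of "{\<rho><..}" UNIV \<rho>] unfolding flight_integral_def by blast
    ultimately show ?thesis using tendsto_unique trivial_limit_at_right_real by blast
  qed
  have "snd w \<le> 0"
  proof (rule ccontr)
    assume "\<not> snd w \<le> 0"
    then have "\<forall>\<^sub>F x in at_left \<rho>. snd (v x) > 0"
      using order_tendstoD(1)[OF tendsto_snd[OF w(1)], of 0] by simp
    then have "\<forall>\<^sub>F x in at_left \<rho>. snd (v x) > 0 \<and> x \<in> {s<..<\<rho>}"
      using eventually_at_left_real[OF assms(1)] by (rule eventually_conj)
    then obtain b where b: "b < \<rho>" "\<And>x. b < x \<Longrightarrow> x < \<rho> \<Longrightarrow> snd (v x) > 0 \<and> s < x"
      unfolding eventually_at_left_field by auto
    define a where "a = (b + \<rho>) / 2"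
    have a: "b < a" "a < \<rho>" using b(1) by (auto simp: a_def)
    have "snd (q a) < snd (q \<rho>)"
    proof (rule DERIV_pos_imp_increasing_open[OF a(2)])
      fix x assume x: "a < x" "x < \<rho>"
      then have "snd (v x) > 0" "x \<notin> R" using b(2)[of x] a free[of x] assms(2) by auto
      then show "\<exists>y. ((\<lambda>t. snd (q t)) has_real_derivative y) (at x) \<and> 0 < y"
        using coordinate_derivs(2) by blast
    qed (intro continuous_intros continuous_q)
    then show False using above_wall[of a] at_wall[OF \<rho>] by simp
  qed
  then show thesis using that left right by blast
qed

text \<open>
  Induction over the finitely many reflections in a time interval: it suffices to treat flights
  without reflection and to pass one reflection at a time.
\<close>

lemma reflection_count_induct:
  assumes "s \<le> t" "s \<notin> R" "t \<notin> R"
    and base: "\<And>t. s \<le> t \<Longrightarrow> R \<inter> {s..t} = {} \<Longrightarrow> P 0 t"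
    and step: "\<And>n t' \<rho> t. P n t' \<Longrightarrow> s \<le> t' \<Longrightarrow> t' \<notin> R \<Longrightarrow> t' < \<rho> \<Longrightarrow> \<rho> < t
        \<Longrightarrow> R \<inter> {t'..t} = {\<rho>} \<Longrightarrow> P (Suc n) t"
  shows "P (card (R \<inter> {s..t})) t"
  using assms(1,3)
proof (induction "card (R \<inter> {s..t})" arbitrary: t)
  case 0
  then show ?case using base[of t] finite_reflections[of s t] by auto
next
  case (Suc n)
  define \<rho> where "\<rho> = Max (R \<inter> {s..t})"
  have ne: "R \<inter> {s..t} \<noteq> {}" using Suc(2) by force
  have "\<rho> \<in> R \<inter> {s..t}" using Max_in[OF finite_reflections ne] by (simp add: \<rho>_def)
  then have \<rho>: "\<rho> \<in> R" "s < \<rho>" "\<rho> < t"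
    using assms(2) Suc.prems(2) by (auto simp: order.order_iff_strict)
  have last: "x \<le> \<rho>" if "x \<in> R" "s \<le> x" "x \<le> t" for x
    using that Max_ge[OF finite_reflections] by (simp add: \<rho>_def)
  \<comment> \<open>the last reflection before \<open>\<rho>\<close>, or \<open>s\<close> if there is none\<close>
  define m where "m = Max (insert s (R \<inter> {s..t} - {\<rho>}))"
  have fin: "finite (insert s (R \<inter> {s..t} - {\<rho>}))" using finite_reflections by simp
  have "m \<in> insert s (R \<inter> {s..t} - {\<rho>})" unfolding m_def by (rule Max_in[OF fin]) simp
  then have m: "s \<le> m" "m < \<rho>" using \<rho> last[of m] by auto
  have m': "x \<le> m" if "x \<in> R" "s \<le> x" "x \<le> t" "x \<noteq> \<rho>" for x
    using that Max_ge[OF fin] by (simp add: m_def)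
  obtain t' where t': "m < t'" "t' < \<rho>" using dense[OF m(2)] by blast
  have nR: "t' \<notin> R" using m'[of t'] t' m \<rho> by auto
  have eq: "R \<inter> {s..t'} = R \<inter> {s..t} - {\<rho>}" using m' t' \<rho> m by force
  have "card (R \<inter> {s..t'}) = n"
    unfolding eq using \<rho> Suc(2) finite_reflections[of s t] by simp
  moreover have "s \<le> t'" using t' m by simp
  ultimately have "P n t'" using Suc(1)[of t'] nR by simp
  moreover have "R \<inter> {t'..t} = {\<rho>}" using m' t' \<rho> m by force
  ultimately have "P (Suc n) t" using step \<open>s \<le> t'\<close> nR t'(2) \<rho>(3) by blast
  then show ?case using Suc(2) by simp
qed

lemma invariant_under_reflection:
  assumes "s \<notin> R" "t \<notin> R" "s \<le> t"
    and free: "\<And>s t. s \<le> t \<Longrightarrow> R \<inter> {s..t} = {} \<Longrightarrow> f s = f t"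
    and cross: "\<And>s \<rho> t. s \<notin> R \<Longrightarrow> s < \<rho> \<Longrightarrow> \<rho> < t \<Longrightarrow> R \<inter> {s..t} = {\<rho>} \<Longrightarrow> f s = f t"
  shows "f s = f t"
  using assms(3,1,2)
  by (rule reflection_count_induct[where P = "\<lambda>_ t. f s = f t"]) (use free cross in auto)

lemma flight_constant_interval:
  assumes "flight_integral \<Phi>" "s \<le> t" "R \<inter> {s..t} = {}"
  shows "\<Phi> (q s) (v s) = \<Phi> (q t) (v t)"
  using flight_constant[OF assms(1), of "{s..t}" s t] assms(2,3) by auto

lemma global_integral:
  assumes \<Phi>: "flight_integral \<Phi>"
    and refl: "\<And>p w. snd p = 1 \<Longrightarrow> \<Phi> p (reflect_velocity w) = \<Phi> p w"
    and "s \<notin> R" "t \<notin> R"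
  shows "\<Phi> (q s) (v s) = \<Phi> (q t) (v t)"
proof -
  have "\<Phi> (q s) (v s) = \<Phi> (q t) (v t)" if "s \<notin> R" "t \<notin> R" "s \<le> t" for s t
    using that
  proof (rule invariant_under_reflection[where f = "\<lambda>t. \<Phi> (q t) (v t)"])
    fix s \<rho> t assume h: "s < \<rho>" "\<rho> < t" "R \<inter> {s..t} = {\<rho>}"
    from crossing[OF this] obtain w where "\<Phi> (q s) (v s) = \<Phi> (q \<rho>) w"
      "\<Phi> (q t) (v t) = \<Phi> (q \<rho>) (reflect_velocity w)" using \<Phi> by metis
    moreover have "\<rho> \<in> R" using h(3) by auto
    ultimately show "\<Phi> (q s) (v s) = \<Phi> (q t) (v t)" using refl at_wall by metis
  qed (rule flight_constant_interval[OF \<Phi>])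
  then show ?thesis using assms(3,4) by (metis linear)
qed

lemma energy_constant:
  "s \<notin> R \<Longrightarrow> t \<notin> R \<Longrightarrow> energy \<mu> (q s) (v s) = energy \<mu> (q t) (v t)"
  using global_integral[OF flight_integrals(2)] energy_reflect by blast

lemma gj_integral_constant:
  "s \<notin> R \<Longrightarrow> t \<notin> R \<Longrightarrow> gj_integral \<mu> (q s) (v s) = gj_integral \<mu> (q t) (v t)"
  using global_integral[OF flight_integral_gj] gj_integral_reflect by blast

lemma arc_apex:
  assumes "s < t" "s \<in> R" "t \<in> R"
  obtains \<tau> where "s < \<tau>" "\<tau> < t" "\<tau> \<notin> R" "snd (v \<tau>) = 0"
    "\<And>x. s \<le> x \<Longrightarrow> x \<le> t \<Longrightarrow> snd (q x) \<le> snd (q \<tau>)"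
proof -
  have "continuous_on {s..t} (\<lambda>t. snd (q t))" by (intro continuous_intros continuous_q)
  then obtain \<tau> where \<tau>: "\<tau> \<in> {s..t}" "\<And>x. x \<in> {s..t} \<Longrightarrow> snd (q x) \<le> snd (q \<tau>)"
    using continuous_attains_sup[of "{s..t}" "\<lambda>t. snd (q t)"] assms(1) by auto
  have "\<not> {s..t} \<subseteq> R \<inter> {s..t}"
    using finite_reflections[of s t] assms(1) finite_subset infinite_Icc by blast
  then obtain y where y: "y \<in> {s..t}" "y \<notin> R" by blast
  have nR: "\<tau> \<notin> R" using \<tau>(2)[OF y(1)] off_wall[OF y(2)] at_wall[of \<tau>] by auto
  then have in': "s < \<tau>" "\<tau> < t" using \<tau>(1) assms by (auto simp: order.order_iff_strict)
  define d where "d = min (\<tau> - s) (t - \<tau>)"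
  have "snd (v \<tau>) = 0"
    by (rule DERIV_local_max[OF coordinate_derivs(2)[OF nR], of d])
      (use in' \<tau>(2) in \<open>auto simp: d_def abs_if split: if_splits\<close>)
  then show thesis using that in' nR \<tau>(2) by auto
qed

end


section \<open>Arcs through the focal point\<close>

locale focal_boltzmann = boltzmann +
  assumes focal: "t \<notin> R \<Longrightarrow> gj_integral \<mu> (q t) (v t) = 2 * \<mu>"
begin

lemma lrl_y_focal:
  "t \<notin> R \<Longrightarrow> lrl_y \<mu> (q t) (v t) = (ang_mom (q t) (v t))\<^sup>2 / 2 - \<mu>"
  using focal[of t] by (simp add: gj_integral_def)

text \<open>
  For \<open>ang_mom = 0\<close> the Laplace-Runge-Lenz vector is \<open>-\<mu>\<close> times the unit vector towards the particle, and
  its vertical component is \<open>-\<mu>\<close>.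
\<close>

lemma radial_motion:
  assumes "t \<notin> R" "ang_mom (q t) (v t) = 0"
  shows "fst (q t) = 0" "fst (v t) = 0"
proof -
  have "snd (q t) = norm (q t)"
    using lrl_y_focal[OF assms(1)] assms(2) mu_pos by (simp add: lrl_y_def field_simps)
  then have "(snd (q t))\<^sup>2 = (fst (q t))\<^sup>2 + (snd (q t))\<^sup>2" by (metis norm_sq_real_prod)
  then show "fst (q t) = 0" by simp
  then show "fst (v t) = 0" using assms(2) above_wall[of t] by (auto simp: ang_mom_def)
qed

lemma ang_mom_zero_iff:
  assumes "s \<notin> R" "t \<notin> R"
  shows "ang_mom (q s) (v s) = 0 \<longleftrightarrow> ang_mom (q t) (v t) = 0"
proof -
  have "(ang_mom (q s) (v s) = 0) = (ang_mom (q t) (v t) = 0)"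
    if "s \<notin> R" "t \<notin> R" "s \<le> t" for s t
    using that
  proof (rule invariant_under_reflection[where f = "\<lambda>t. ang_mom (q t) (v t) = 0"])
    fix s \<rho> t assume nR: "s \<notin> R" and h: "s < \<rho>" "\<rho> < t" "R \<inter> {s..t} = {\<rho>}"
    from crossing[OF h] obtain w where w:
      "\<And>\<Phi>. flight_integral \<Phi> \<Longrightarrow> \<Phi> (q s) (v s) = \<Phi> (q \<rho>) w"
      "\<And>\<Phi>. flight_integral \<Phi> \<Longrightarrow> \<Phi> (q t) (v t) = \<Phi> (q \<rho>) (reflect_velocity w)" by metis
    have \<rho>: "\<rho> \<in> R" using h(3) by auto
    have "gj_integral \<mu> (q \<rho>) w = 2 * \<mu>" 
      using w(1)[OF flight_integral_gj] focal[OF nR] by simp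
    then show "(ang_mom (q s) (v s) = 0) = (ang_mom (q t) (v t) = 0)"
      using focal_reflect_ang_mom_zero[OF mu_pos at_wall[OF \<rho>]] w[OF flight_integrals(1)] by simp
  qed (simp add: flight_constant_interval[OF flight_integrals(1)])
  then show ?thesis using assms by (metis linear)
qed

text \<open>
  The slope \<open>x\<^sub>1 / x\<^sub>2\<close> has the derivative \<open>- ang_mom / x\<^sub>2\<^sup>2\<close> and is therefore strictly monotone, so the arc
  does not end where it began.  Its endpoints then lie on opposite sides of the axis, and the orbit equation at
  the crossing reads \<open>ang_mom\<^sup>2 / 2 * x\<^sub>2 = ang_mom\<^sup>2\<close>.
\<close>

lemma curved_arc_contains_focal_point:
  assumes arc: "s < t" "s \<in> R" "t \<in> R" "R \<inter> {s<..<t} = {}"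
    and L0: "\<And>x. x \<notin> R \<Longrightarrow> ang_mom (q x) (v x) \<noteq> 0"
  shows "focal_point \<in> q ` {s..t}"
proof -
  define m where "m = (s + t) / 2"
  define L where "L = ang_mom (q m) (v m)"
  define A where "A = lrl_x \<mu> (q m) (v m)"
  have m: "m \<in> {s<..<t}" using arc(1) by (simp add: m_def)
  then have nR: "m \<notin> R" using arc(4) by blast
  have const: "\<Phi> (q x) (v x) = \<Phi> (q m) (v m)" if "flight_integral \<Phi>" "x \<in> {s<..<t}" for \<Phi> x
    using flight_constant[OF that(1), of "{s<..<t}" x m] that(2) m arc(4) by auto
  have L: "L \<noteq> 0" using L0[OF nR] by (simp add: L_def)
  \<comment> \<open>extended to the endpoints by continuity of \<open>q\<close>, as the velocity jumps there\<close>
  have orbit: "\<mu> * norm (q x) + A * fst (q x) + (L\<^sup>2 / 2 - \<mu>) * snd (q x) = L\<^sup>2"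
    if "x \<in> {s..t}" for x
  proof (rule continuous_constant_on_closure[where S = "{s<..<t}"
        and f = "\<lambda>x. \<mu> * norm (q x) + A * fst (q x) + (L\<^sup>2 / 2 - \<mu>) * snd (q x)"])
    fix y assume y: "y \<in> {s<..<t}"
    show "\<mu> * norm (q y) + A * fst (q y) + (L\<^sup>2 / 2 - \<mu>) * snd (q y) = L\<^sup>2"
      using orbit_equation[OF q_nonzero, of y "v y" \<mu>] const[OF flight_integrals(1) y]
        const[OF flight_integrals(3) y] const[OF flight_integrals(4) y] lrl_y_focal[OF nR]
      by (simp add: L_def A_def)
  qed (use that arc(1) in \<open>auto intro!: continuous_intros continuous_q\<close>)
  have wall: "\<mu> * norm (fst (q x), 1::real) + A * fst (q x) = L\<^sup>2 / 2 + \<mu>"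
    if "x \<in> {s..t}" "x \<in> R" for x
  proof -
    have "q x = (fst (q x), 1)" using at_wall[OF that(2)] by (simp add: prod_eq_iff)
    then show ?thesis using orbit[OF that(1)] at_wall[OF that(2)] by (simp add: algebra_simps)
  qed
  have slope: "((\<lambda>x. fst (q x) / snd (q x)) has_real_derivative - L / (snd (q x))\<^sup>2) (at x)"
    if "x \<in> {s<..<t}" for x
  proof -
    have "x \<notin> R" using that arc(4) by blast
    moreover have "L = ang_mom (q x) (v x)" using const[OF flight_integrals(1) that] by (simp add: L_def)
    ultimately show ?thesis using above_wall[of x]
      by (auto intro!: derivative_eq_intros coordinate_derivs simp: ang_mom_def power2_eq_square)
  qed
  have "fst (q s) / snd (q s) \<noteq> fst (q t) / snd (q t)"
  proof -
    have nz: "snd (q x) \<noteq> 0" for x using above_wall[of x] by auto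
    have cont: "continuous_on {s..t} (\<lambda>x. fst (q x) / snd (q x))"
      using nz by (intro continuous_intros continuous_q) auto
    consider "L < 0" | "L > 0" using L by linarith
    then show ?thesis
    proof cases
      case 1
      then have "0 < - L / (snd (q x))\<^sup>2" for x using nz[of x] by (simp add: divide_neg_pos)
      then have "fst (q s) / snd (q s) < fst (q t) / snd (q t)"
        using DERIV_pos_imp_increasing_open[OF arc(1) _ cont] slope by (metis greaterThanLessThan_iff)
      then show ?thesis by simp
    next
      case 2
      then have "- L / (snd (q x))\<^sup>2 < 0" for x using nz[of x] by simp
      then have "fst (q t) / snd (q t) < fst (q s) / snd (q s)"
        using DERIV_neg_imp_decreasing_open[OF arc(1) _ cont] slope by (metis greaterThanLessThan_iff)
      then show ?thesis by simp
    qed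
  qed
  then have "fst (q s) \<noteq> fst (q t)" using at_wall arc(2,3) by simp
  then have opp: "fst (q s) * fst (q t) < 0"
    using wall_points_opposite[OF mu_pos, of "L\<^sup>2 / 2 + \<mu>" _ _ A] wall[of s] wall[of t] arc L by simp
  have "\<exists>x\<in>{s..t}. fst (q x) = 0"
  proof -
    have cont: "continuous_on {s..t} (\<lambda>x. fst (q x))" by (intro continuous_intros continuous_q)
    consider "fst (q s) \<le> 0" "0 \<le> fst (q t)" | "fst (q t) \<le> 0" "0 \<le> fst (q s)"
      using opp by (auto simp: mult_less_0_iff)
    then show ?thesis
    proof cases
      case 1
      then show ?thesis using IVT'[OF 1 _ cont] arc(1) by auto
    next
      case 2
      then show ?thesis using IVT2'[OF 2 _ cont] arc(1) by auto
    qed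
  qed
  then obtain x where x: "x \<in> {s..t}" "fst (q x) = 0" by blast
  have "norm (q x) = snd (q x)" using x(2) above_wall[of x] by (simp add: norm_prod_def)
  then have "L\<^sup>2 / 2 * snd (q x) = L\<^sup>2" using orbit[OF x(1)] x(2) by (simp add: algebra_simps)
  then have "snd (q x) = 2" using L by simp
  then have "q x = focal_point" using x(2) by (simp add: focal_point_def prod_eq_iff)
  then show ?thesis using x(1) by force
qed

text \<open>
  On the axis the orbit equation degenerates, and whether an arc reaches the focal point depends on
  its height alone.  At the apex the energy is purely potential, hence all arcs have the same height.
\<close>

lemma vertical_arc_contains_focal_point:
  assumes arc: "s < t" "s \<in> R" "t \<in> R"
    and arc': "s' < t'" "s' \<in> R" "t' \<in> R" "focal_point \<in> q ` {s'..t'}"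
    and L0: "\<And>x. x \<notin> R \<Longrightarrow> ang_mom (q x) (v x) = 0"
  shows "focal_point \<in> q ` {s..t}"
proof -
  obtain \<tau> where \<tau>: "s < \<tau>" "\<tau> < t" "\<tau> \<notin> R" "snd (v \<tau>) = 0"
    using arc_apex[OF arc] by metis
  obtain \<tau>' where \<tau>': "s' < \<tau>'" "\<tau>' < t'" "\<tau>' \<notin> R" "snd (v \<tau>') = 0"
    and top: "\<And>x. s' \<le> x \<Longrightarrow> x \<le> t' \<Longrightarrow> snd (q x) \<le> snd (q \<tau>')"
    using arc_apex[OF arc'(1-3)] by metis
  have apex_energy: "energy \<mu> (q x) (v x) = - \<mu> / snd (q x)" if "x \<notin> R" "snd (v x) = 0" for x
    using radial_motion[OF that(1) L0[OF that(1)]] that(2) above_wall[of x]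
    by (simp add: energy_def norm_prod_def)
  have "snd (q \<tau>) = snd (q \<tau>')"
    using apex_energy[of \<tau>] apex_energy[of \<tau>'] energy_constant[of \<tau> \<tau>'] \<tau> \<tau>' mu_pos
      above_wall[of \<tau>] above_wall[of \<tau>'] by (simp add: field_simps)
  moreover obtain x where "x \<in> {s'..t'}" "q x = focal_point" using arc'(4) by auto
  then have "2 \<le> snd (q \<tau>')" using top[of x] by (simp add: focal_point_def)
  ultimately obtain y where y: "s \<le> y" "y \<le> \<tau>" "snd (q y) = 2"
    using IVT'[of "\<lambda>x. snd (q x)" s 2 \<tau>] at_wall[OF arc(2)] \<tau>(1)
    by (auto intro!: continuous_intros continuous_q)
  have "y \<notin> R" using y(3) at_wall by force
  then have "q y = focal_point"
    using radial_motion(1) L0 y(3) by (simp add: focal_point_def prod_eq_iff)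
  then show ?thesis using y \<tau>(2) by force
qed

section \<open>Decay of the angular momentum\<close>

lemma reflection_count_unbounded:
  assumes "reflects_forever q"
  shows "\<exists>T. \<forall>t\<ge>T. N \<le> card (R \<inter> {s..t})"
proof -
  have "R \<inter> {0..} \<subseteq> R \<inter> {0..s} \<union> R \<inter> {s..}" by auto
  then have "infinite (R \<inter> {s..})"
    using assms finite_reflections[of 0 s] unfolding reflects_forever_def
    by (meson finite_UnI finite_subset)
  then obtain B where B: "finite B" "card B = N" "B \<subseteq> R \<inter> {s..}"
    using infinite_arbitrarily_large by blast
  have "N \<le> card (R \<inter> {s..t})" if "t \<ge> Max (insert s B)" for t
  proof -
    have "B \<subseteq> R \<inter> {s..t}" using B that by auto
    then show ?thesis using card_mono[OF finite_reflections] B(2) by blast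
  qed
  then show ?thesis by blast
qed

lemma lrl_x_bound:
  assumes "t \<notin> R" and c: "c \<ge> 0" "2 * energy \<mu> (q t) (v t) + \<mu> \<le> c\<^sup>2"
  shows "\<bar>lrl_x \<mu> (q t) (v t)\<bar> \<le> c * \<bar>ang_mom (q t) (v t)\<bar>"
proof -
  have "0 \<le> ((ang_mom (q t) (v t))\<^sup>2)\<^sup>2 / 4" by simp
  then have "(lrl_x \<mu> (q t) (v t))\<^sup>2 \<le> (c * ang_mom (q t) (v t))\<^sup>2"
    using lrl_x_focal[OF q_nonzero focal[OF assms(1)]]
      mult_right_mono[OF c(2) zero_le_power2, of "ang_mom (q t) (v t)"]
    unfolding power_mult_distrib by linarith
  then show ?thesis using c(1) by (metis abs_le_square_iff abs_mult abs_of_nonneg)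
qed

text \<open>
  \<open>- 1/2\<close> times the cotangent of half the angle between the upward vertical and the velocity that the current
  orbit has at \<open>(0, 2)\<close>.  The limit 0 stands for a vertical passage downwards.
\<close>

definition phase where
  "phase c t = (c * ang_mom (q t) (v t) + lrl_x \<mu> (q t) (v t)) / (ang_mom (q t) (v t))\<^sup>2"

lemma phase_decay:
  assumes s: "s \<notin> R" "ang_mom (q s) (v s) \<noteq> 0" and t: "t \<notin> R" "s \<le> t"
    and c: "c \<ge> 0" "c\<^sup>2 = 2 * energy \<mu> (q s) (v s) + \<mu>"
    and k: "k \<ge> 0" "k\<^sup>2 = 2 * energy \<mu> (q s) (v s) + 2 * \<mu>"
  shows "\<bar>phase c t\<bar> = ((k - c) / (k + c)) ^ card (R \<inter> {s..t}) * \<bar>phase c s\<bar>"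
  using t(2) s(1) t(1)
proof (rule reflection_count_induct[where
      P = "\<lambda>n t. \<bar>phase c t\<bar> = ((k - c) / (k + c)) ^ n * \<bar>phase c s\<bar>"])
  fix t assume h: "s \<le> t" "R \<inter> {s..t} = {}"
  show "\<bar>phase c t\<bar> = ((k - c) / (k + c)) ^ 0 * \<bar>phase c s\<bar>"
    using flight_constant_interval[OF flight_integrals(1) h] flight_constant_interval[OF flight_integrals(3) h]
    by (simp add: phase_def)
next
  fix n x \<rho> t
  assume IH: "\<bar>phase c x\<bar> = ((k - c) / (k + c)) ^ n * \<bar>phase c s\<bar>"
    and x: "x \<notin> R" and h: "x < \<rho>" "\<rho> < t" "R \<inter> {x..t} = {\<rho>}"
  have "c\<^sup>2 < k\<^sup>2" using c k mu_pos by simp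
  then have ck: "c < k" using k(1) by (rule power_less_imp_less_base)
  from crossing[OF h] obtain w where down: "snd w \<le> 0"
    and w: "\<And>\<Phi>. flight_integral \<Phi> \<Longrightarrow> \<Phi> (q x) (v x) = \<Phi> (q \<rho>) w"
      "\<And>\<Phi>. flight_integral \<Phi> \<Longrightarrow> \<Phi> (q t) (v t) = \<Phi> (q \<rho>) (reflect_velocity w)" by metis
  have \<rho>: "\<rho> \<in> R" using h(3) by auto
  have D: "gj_integral \<mu> (q \<rho>) w = 2 * \<mu>" 
    using w(1)[OF flight_integral_gj] focal[OF x] by simp
  have E: "energy \<mu> (q \<rho>) w = energy \<mu> (q s) (v s)"
    using w(1)[OF flight_integrals(2)] energy_constant[OF s(1) x] by simp
  have L: "ang_mom (q \<rho>) w \<noteq> 0"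
    using w(1)[OF flight_integrals(1)] ang_mom_zero_iff[OF s(1) x] s(2) by simp
  have "(k + c) * phase c t = - (k - c) * phase c x"
    using focal_reflect_contraction[OF mu_pos at_wall[OF \<rho>] D down L, of c k] c k E
      w(1)[OF flight_integrals(1)] w(2)[OF flight_integrals(1)]
      w(1)[OF flight_integrals(3)] w(2)[OF flight_integrals(3)]
    by (simp add: phase_def)
  then have "phase c t = - ((k - c) / (k + c)) * phase c x"
    using ck c(1) by (simp add: field_simps)
  then have "\<bar>phase c t\<bar> = (k - c) / (k + c) * \<bar>phase c x\<bar>"
    using ck c(1) by (simp add: abs_mult)
  then show "\<bar>phase c t\<bar> = ((k - c) / (k + c)) ^ Suc n * \<bar>phase c s\<bar>"
    using IH by simp
qed

text \<open>
  With the velocity \<open>(a, b)\<close> at \<open>(0, 2)\<close> one has \<open>(c - b) (c + b) = a\<^sup>2\<close>, so that \<open>|a|\<close> is \<open>|c - b|\<close>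
  times \<open>|c + b| / |a|\<close>, where \<open>|c - b| \<le> 2c\<close>.
\<close>

lemma ang_mom_le_phase:
  assumes t: "t \<notin> R" "ang_mom (q t) (v t) \<noteq> 0"
    and c: "c \<ge> 0" "c\<^sup>2 = 2 * energy \<mu> (q t) (v t) + \<mu>"
  shows "\<bar>ang_mom (q t) (v t)\<bar> \<le> 8 * c * \<bar>phase c t\<bar>"
proof -
  define L A where "L = ang_mom (q t) (v t)" and "A = lrl_x \<mu> (q t) (v t)"
  have L: "\<bar>L\<bar> > 0" using t(2) by (simp add: L_def)
  have A: "\<bar>A\<bar> \<le> c * \<bar>L\<bar>" using lrl_x_bound[OF t(1) c(1)] c(2) by (simp add: L_def A_def)
  have "(c * L - A) * (c * L + A) = (L\<^sup>2)\<^sup>2 / 4"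
    using lrl_x_focal[OF q_nonzero focal[OF t(1)]] c(2) unfolding L_def[symmetric] A_def[symmetric]
    by (simp add: power2_eq_square algebra_simps)
  moreover have "c * L + A = L\<^sup>2 * phase c t"
    using L unfolding phase_def L_def[symmetric] A_def[symmetric] by simp
  ultimately have "L\<^sup>2 * L\<^sup>2 = L\<^sup>2 * (4 * (c * L - A) * phase c t)" by algebra
  then have "L\<^sup>2 = 4 * (c * L - A) * phase c t"
    using L by (simp only: mult_cancel_left) simp
  then have "\<bar>L\<bar> * \<bar>L\<bar> = 4 * \<bar>c * L - A\<bar> * \<bar>phase c t\<bar>"
    by (metis abs_mult abs_numeral power2_eq_square)
  also have "\<dots> \<le> 4 * (2 * c * \<bar>L\<bar>) * \<bar>phase c t\<bar>"
  proof (intro mult_right_mono mult_left_mono)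
    have "\<bar>c * L - A\<bar> \<le> \<bar>c * L\<bar> + \<bar>A\<bar>" by simp
    also have "\<bar>c * L\<bar> = c * \<bar>L\<bar>" using c(1) by (simp add: abs_mult)
    finally show "\<bar>c * L - A\<bar> \<le> 2 * c * \<bar>L\<bar>" using A by simp
  qed simp_all
  finally have "\<bar>L\<bar> * \<bar>L\<bar> \<le> \<bar>L\<bar> * (8 * c * \<bar>phase c t\<bar>)" by (simp add: algebra_simps)
  then have "\<bar>L\<bar> \<le> 8 * c * \<bar>phase c t\<bar>" using L mult_le_cancel_left_pos by blast
  then show ?thesis by (simp add: L_def)
qed

lemma exists_flight_time: "\<exists>t. t \<notin> R"
proof -
  have "\<not> {0..1} \<subseteq> R \<inter> {0..1::real}"
    using finite_reflections[of 0 1] infinite_Icc[of "0::real" 1] by (metis finite_subset zero_less_one)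
  then show ?thesis by blast
qed

lemma eventually_small_ang_mom:
  assumes "reflects_forever q" "\<epsilon> > 0"
  shows "\<exists>T. \<forall>t\<ge>T. t \<notin> R \<longrightarrow> \<bar>ang_mom (q t) (v t)\<bar> < \<epsilon>"
proof -
  obtain s where s: "s \<notin> R" using exists_flight_time by blast
  show ?thesis
  proof (cases "ang_mom (q s) (v s) = 0")
    case True
    then show ?thesis using ang_mom_zero_iff[OF s] assms(2) by auto
  next
    case False
    define E where "E = energy \<mu> (q s) (v s)"
    define c k where "c = sqrt (2 * E + \<mu>)" and "k = sqrt (2 * E + 2 * \<mu>)"
    define \<kappa> where "\<kappa> = (k - c) / (k + c)"
    have "0 \<le> (lrl_x \<mu> (q s) (v s))\<^sup>2" by simp
    also have "\<dots> < (2 * E + \<mu>) * (ang_mom (q s) (v s))\<^sup>2"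
      using lrl_x_focal[OF q_nonzero focal[OF s]] False by (simp add: E_def)
    finally have pos: "2 * E + \<mu> > 0" by (simp add: zero_less_mult_iff)
    then have c: "c > 0" "c\<^sup>2 = 2 * E + \<mu>" by (simp_all add: c_def)
    have k: "k > c" "k\<^sup>2 = 2 * E + 2 * \<mu>" using pos mu_pos by (simp_all add: c_def k_def)
    have "0 \<le> \<kappa>" "\<kappa> < 1" using c k by (simp_all add: \<kappa>_def)
    then have "(\<lambda>n. 8 * c * (\<kappa> ^ n * \<bar>phase c s\<bar>)) \<longlonglongrightarrow> 8 * c * (0 * \<bar>phase c s\<bar>)"
      by (intro tendsto_intros LIMSEQ_realpow_zero)
    then have "\<forall>\<^sub>F n in sequentially. 8 * c * (\<kappa> ^ n * \<bar>phase c s\<bar>) < \<epsilon>"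
      using assms(2) by (simp add: order_tendstoD)
    then obtain N where N: "\<And>n. n \<ge> N \<Longrightarrow> 8 * c * (\<kappa> ^ n * \<bar>phase c s\<bar>) < \<epsilon>"
      by (auto simp: eventually_sequentially)
    obtain T where T: "\<And>t. t \<ge> T \<Longrightarrow> N \<le> card (R \<inter> {s..t})"
      using reflection_count_unbounded[OF assms(1)] by blast
    have "\<bar>ang_mom (q t) (v t)\<bar> < \<epsilon>" if t: "t \<ge> max s T" "t \<notin> R" for t
    proof -
      have "\<bar>ang_mom (q t) (v t)\<bar> \<le> 8 * c * \<bar>phase c t\<bar>"
        using ang_mom_le_phase[OF t(2)] ang_mom_zero_iff[OF s t(2)] False c
          energy_constant[OF s t(2)] by (simp add: E_def)
      also have "\<bar>phase c t\<bar> = \<kappa> ^ card (R \<inter> {s..t}) * \<bar>phase c s\<bar>"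
        using phase_decay[OF s False t(2), of c k] t(1) c k by (simp add: E_def \<kappa>_def)
      also have "8 * c * (\<kappa> ^ card (R \<inter> {s..t}) * \<bar>phase c s\<bar>) < \<epsilon>" using N T t(1) by simp
      finally show ?thesis .
    qed
    then show ?thesis by blast
  qed
qed

section \<open>Convergence to the vertical axis\<close>

text \<open>
  At an apex of height \<open>Y\<close> and distance \<open>r\<close>, a nonnegative energy gives the speed at least \<open>sqrt (2\<mu>/r)\<close>
  and so \<open>2\<mu> Y\<^sup>2 \<le> L\<^sup>2 r\<close>.  For small \<open>L\<close> the orbit equation makes \<open>r\<close> comparable to \<open>Y\<close>, which leaves no
  room for a height above the wall.
\<close>

lemma energy_negative:
  assumes forever: "reflects_forever q" and x: "x \<notin> R"
  shows "energy \<mu> (q x) (v x) < 0"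
proof (rule ccontr)
  define E where "E = energy \<mu> (q x) (v x)"
  define c where "c = sqrt (2 * E + \<mu>)"
  \<comment> \<open>so small that \<open>|L| < \<epsilon>\<close> entails \<open>L\<^sup>2 < \<mu> / 2\<close> and \<open>c * |L| \<le> \<mu> / 2\<close>\<close>
  define \<epsilon> where "\<epsilon> = min (sqrt (\<mu> / 2)) (\<mu> / (2 * c))"
  assume "\<not> energy \<mu> (q x) (v x) < 0"
  then have E: "E \<ge> 0" by (simp add: E_def)
  then have c: "c > 0" "c\<^sup>2 = 2 * E + \<mu>" using mu_pos by (simp_all add: c_def)
  have "\<epsilon> > 0" using mu_pos c by (simp add: \<epsilon>_def)
  then obtain T where T: "\<And>t. t \<ge> T \<Longrightarrow> t \<notin> R \<Longrightarrow> \<bar>ang_mom (q t) (v t)\<bar> < \<epsilon>"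
    using eventually_small_ang_mom[OF forever] by blast
  have "\<exists>s t. T \<le> s \<and> s < t \<and> s \<in> R \<and> t \<in> R"
  proof -
    obtain b where "2 \<le> card (R \<inter> {T..b})"
      using reflection_count_unbounded[OF forever] by blast
    then obtain s t where "s \<in> R \<inter> {T..b}" "t \<in> R \<inter> {T..b}" "s \<noteq> t"
      by (meson card_2_iff' ex_card subset_iff)
    then show ?thesis by (cases "s < t") (auto, force)
  qed
  then obtain s t where st: "T \<le> s" "s < t" "s \<in> R" "t \<in> R" by blast
  obtain \<tau> where \<tau>: "s < \<tau>" "\<tau> \<notin> R" "snd (v \<tau>) = 0" using arc_apex[OF st(2-4)] by metis
  define L where "L = ang_mom (q \<tau>) (v \<tau>)"
  define X Y r where "X = fst (q \<tau>)" and "Y = snd (q \<tau>)" and "r = norm (q \<tau>)"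
  have Y: "Y \<ge> 1" using above_wall by (simp add: Y_def)
  have r: "r > 0" "\<bar>X\<bar> \<le> r"
    using norm_fst_le[of "fst (q \<tau>)" "snd (q \<tau>)"] by (simp_all add: r_def X_def)
  have "\<bar>L\<bar> < \<epsilon>" using T[of \<tau>] \<tau> st(1) by (simp add: L_def)
  then have small: "\<bar>L\<bar> < sqrt (\<mu> / 2)" "\<bar>L\<bar> < \<mu> / (2 * c)" by (simp_all add: \<epsilon>_def)
  have L2: "L\<^sup>2 < \<mu> / 2"
    using power_strict_mono[OF small(1), of 2] mu_pos by simp
  have cL: "c * \<bar>L\<bar> \<le> \<mu> / 2" using small(2) c(1) by (simp add: field_simps)
  have eE: "energy \<mu> (q \<tau>) (v \<tau>) = E" using energy_constant[OF x \<tau>(2)] by (simp add: E_def)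
  have "(fst (v \<tau>))\<^sup>2 \<ge> 2 * \<mu> / r"
    using eE E \<tau>(3) by (simp add: energy_def norm_sq_real_prod r_def)
  then have "Y\<^sup>2 * (2 * \<mu> / r) \<le> Y\<^sup>2 * (fst (v \<tau>))\<^sup>2" by (intro mult_left_mono) auto
  also have "\<dots> = L\<^sup>2" using \<tau>(3) by (simp add: L_def ang_mom_def Y_def power_mult_distrib)
  finally have fast: "2 * \<mu> * Y\<^sup>2 \<le> L\<^sup>2 * r" using r(1) by (simp add: field_simps)
  have "L\<^sup>2 = \<mu> * r + lrl_x \<mu> (q \<tau>) (v \<tau>) * X + (L\<^sup>2 / 2 - \<mu>) * Y"
    using orbit_equation[OF q_nonzero, of \<tau> "v \<tau>" \<mu>] lrl_y_focal[OF \<tau>(2)]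
    by (simp add: L_def X_def Y_def r_def)
  moreover have "\<bar>lrl_x \<mu> (q \<tau>) (v \<tau>) * X\<bar> \<le> \<mu> / 2 * r"
    unfolding abs_mult
    using lrl_x_bound[OF \<tau>(2), of c] c eE cL r by (intro mult_mono) (auto simp: L_def)
  moreover have "0 \<le> L\<^sup>2 / 2 * Y" using Y by simp
  ultimately have "\<mu> / 2 * r \<le> L\<^sup>2 + \<mu> * Y" by (simp add: algebra_simps)
  also have "\<dots> \<le> \<mu> * Y + \<mu> * Y"
  proof -
    have "\<mu> * 1 \<le> \<mu> * Y" using Y mu_pos by (intro mult_left_mono) auto
    then show ?thesis using L2 mu_pos by linarith
  qed
  finally have "r \<le> 4 * Y" using mu_pos by simp
  have "2 * \<mu> * Y\<^sup>2 \<le> L\<^sup>2 * r" by (rule fast)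
  also have "\<dots> \<le> \<mu> / 2 * (4 * Y)" using \<open>r \<le> 4 * Y\<close> L2 r(1) mu_pos by (intro mult_mono) auto
  also have "\<dots> = 2 * \<mu> * Y" by simp
  finally have "Y * Y \<le> Y * 1" using mu_pos by (simp add: power2_eq_square)
  then have "Y = 1" using Y by simp
  then show False using off_wall[OF \<tau>(2)] by (simp add: Y_def)
qed

text \<open>
  The negative energy \<open>E\<close> keeps the particle within the distance \<open>M = \<mu> / |E|\<close>.  By the orbit equation
  \<open>\<mu> (r - x\<^sub>2)\<close> is small with \<open>L\<close>, and \<open>x\<^sub>1\<^sup>2 = (r - x\<^sub>2) (r + x\<^sub>2)\<close> with \<open>r + x\<^sub>2 \<le> 2M\<close>.
\<close>

lemma converges_to_axis:
  assumes forever: "reflects_forever q"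
  shows "((\<lambda>t. fst (q t)) \<longlongrightarrow> 0) at_top"
proof (rule tendstoI)
  fix \<epsilon> :: real assume "\<epsilon> > 0"
  define \<delta> where "\<delta> = \<epsilon> / 2"
  have \<delta>: "\<delta> > 0" "\<delta> < \<epsilon>" using \<open>\<epsilon> > 0\<close> by (simp_all add: \<delta>_def)
  obtain s where s: "s \<notin> R" using exists_flight_time by blast
  define E where "E = energy \<mu> (q s) (v s)"
  define c where "c = sqrt \<bar>2 * E + \<mu>\<bar>"
  define M where "M = \<mu> / (- E)"
  have E: "E < 0" using energy_negative[OF forever s] by (simp add: E_def)
  have M: "M > 0" using E mu_pos by (simp add: M_def divide_pos_neg)
  have c: "c \<ge> 0" by (simp add: c_def)
  define \<eta> where "\<eta> = min 1 (\<mu> * \<delta>\<^sup>2 / (2 * M * (1 + c * M)))"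
  have cM: "1 + c * M > 0" using c M by (simp add: add_pos_nonneg)
  have "\<eta> > 0" using mu_pos M cM \<delta> by (simp add: \<eta>_def)
  then obtain T where T: "\<And>t. t \<ge> T \<Longrightarrow> t \<notin> R \<Longrightarrow> \<bar>ang_mom (q t) (v t)\<bar> < \<eta>"
    using eventually_small_ang_mom[OF forever] by blast
  have bound: "\<bar>fst (q t)\<bar> \<le> \<delta>" if t: "t \<ge> T" "t \<notin> R" for t
  proof -
    define L where "L = ang_mom (q t) (v t)"
    define A where "A = lrl_x \<mu> (q t) (v t)"
    define X Y r where "X = fst (q t)" and "Y = snd (q t)" and "r = norm (q t)"
    have L: "\<bar>L\<bar> \<le> 1" "\<bar>L\<bar> \<le> \<mu> * \<delta>\<^sup>2 / (2 * M * (1 + c * M))"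
      using T[OF t] by (simp_all add: L_def \<eta>_def)
    have eE: "energy \<mu> (q t) (v t) = E" using energy_constant[OF s t(2)] by (simp add: E_def)
    have r: "r > 0" "r\<^sup>2 = X\<^sup>2 + Y\<^sup>2" "\<bar>X\<bar> \<le> r" "Y \<le> r" "Y \<ge> 1"
      using norm_fst_le[of "fst (q t)" "snd (q t)"] norm_snd_le[of "snd (q t)" "fst (q t)"] above_wall[of t]
      by (simp_all add: r_def X_def Y_def norm_sq_real_prod)
    have "E + \<mu> / r = (norm (v t))\<^sup>2 / 2" using eE by (simp add: energy_def r_def)
    then have "0 \<le> E + \<mu> / r" by (metis divide_nonneg_pos zero_le_power2 zero_less_numeral)
    then have rM: "r \<le> M" using E r(1) by (simp add: M_def field_simps)
    have A: "\<bar>A\<bar> \<le> c * \<bar>L\<bar>"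
      using lrl_x_bound[OF t(2) c] eE by (simp add: c_def A_def L_def)
    have orb: "L\<^sup>2 = \<mu> * r + A * X + (L\<^sup>2 / 2 - \<mu>) * Y"
      using orbit_equation[OF q_nonzero, of t "v t" \<mu>] lrl_y_focal[OF t(2)]
      by (simp add: L_def A_def X_def Y_def r_def)
    have "\<mu> * (r - Y) = L\<^sup>2 - A * X - L\<^sup>2 / 2 * Y" using orb by (simp add: algebra_simps)
    also have "\<dots> \<le> \<bar>L\<bar> * 1 + c * \<bar>L\<bar> * M"
    proof -
      have "0 \<le> L\<^sup>2 / 2 * Y" using r by simp
      moreover have "L\<^sup>2 \<le> \<bar>L\<bar> * 1"
        using L(1) by (metis abs_ge_zero abs_mult_self_eq mult_left_mono power2_eq_square)
      moreover have "\<bar>A * X\<bar> \<le> c * \<bar>L\<bar> * M"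
        unfolding abs_mult using A r rM c by (intro mult_mono) auto
      ultimately show ?thesis by linarith
    qed
    also have "\<dots> = \<bar>L\<bar> * (1 + c * M)" by (simp add: algebra_simps)
    finally have near: "\<mu> * (r - Y) \<le> \<bar>L\<bar> * (1 + c * M)" .
    have "\<mu> * X\<^sup>2 = \<mu> * (r - Y) * (r + Y)" using r(2) by (simp add: algebra_simps power2_eq_square)
    also have "\<dots> \<le> \<bar>L\<bar> * (1 + c * M) * (2 * M)"
      by (rule mult_mono[OF near]) (use r rM cM in auto)
    also have "\<dots> \<le> \<mu> * \<delta>\<^sup>2"
    proof -
      have "2 * M * (1 + c * M) > 0" using M cM by simp
      then have "\<bar>L\<bar> * (2 * M * (1 + c * M)) \<le> \<mu> * \<delta>\<^sup>2"
        using L(2) pos_le_divide_eq by blast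
      then show ?thesis by (simp add: mult_ac)
    qed
    finally have "X\<^sup>2 \<le> \<delta>\<^sup>2" using mu_pos by simp
    then show ?thesis using \<delta>(1) by (simp add: X_def abs_le_square_iff[symmetric])
  qed
  \<comment> \<open>reflection times are isolated, so continuity extends the bound to them\<close>
  have "\<bar>fst (q t)\<bar> \<le> \<delta>" if t: "t \<ge> T" for t
  proof (rule tendsto_upperbound)
    show "((\<lambda>x. \<bar>fst (q x)\<bar>) \<longlongrightarrow> \<bar>fst (q t)\<bar>) (at_right t)"
      using isCont_q[of t] by (intro tendsto_intros) (auto simp: isCont_def intro: tendsto_within_subset)
    have "\<forall>\<^sub>F x in at_right t. x \<notin> R \<inter> {t..t + 1}"
    proof -
      have "\<forall>\<^sub>F x in at t. x \<notin> R \<inter> {t..t + 1}"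
        using finite_reflections[of t "t + 1"] islimpt_finite islimpt_iff_eventually by blast
      then show ?thesis by (simp add: eventually_at_split)
    qed
    moreover have "\<forall>\<^sub>F x in at_right t. x \<in> {t<..<t + 1}"
      by (rule eventually_at_right_real) simp
    ultimately show "\<forall>\<^sub>F x in at_right t. \<bar>fst (q x)\<bar> \<le> \<delta>"
      by eventually_elim (use bound t in auto)
  qed simp
  then show "\<forall>\<^sub>F t in at_top. dist (fst (q t)) 0 < \<epsilon>"
    using \<delta>(2) unfolding eventually_at_top_linorder by (metis dist_0_norm dist_commute le_less_trans real_norm_def)
qed

end

section \<open>The focal reflection property\<close>

theorem theorem3p4:
  fixes \<mu> :: real and q v :: "real \<Rightarrow> real \<times> real" and A\<^sub>0 :: "(real \<times> real) set"
  assumes "\<mu> > 0"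
    and "boltzmann_trajectory \<mu> q v"
    and "is_arc q A\<^sub>0" and "focal_point \<in> A\<^sub>0"
  shows "(\<forall>A. is_arc q A \<longrightarrow> focal_point \<in> A) \<and>
         (reflects_forever q \<longrightarrow> converges_to_vertical_axis q)"
proof -
  interpret boltzmann \<mu> q v using assms by unfold_locales
  obtain s\<^sub>0 t\<^sub>0 where arc0: "s\<^sub>0 < t\<^sub>0" "s\<^sub>0 \<in> R" "t\<^sub>0 \<in> R" and F0: "focal_point \<in> q ` {s\<^sub>0..t\<^sub>0}"
    using assms(3,4) by (auto simp: is_arc_def)
  then obtain \<tau> where \<tau>: "q \<tau> = (0, 2)" by (auto simp: focal_point_def)
  then have nR: "\<tau> \<notin> R" using at_wall[of \<tau>] by auto
  \<comment> \<open>at \<open>(0, 2)\<close> the contributions of the velocity to the integral cancel\<close>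
  have "gj_integral \<mu> (q \<tau>) (v \<tau>) = 2 * \<mu>"
    by (simp add: \<tau> gj_integral_def lrl_y_def ang_mom_def norm_prod_def power2_eq_square)
  then interpret focal_boltzmann \<mu> q v
    by unfold_locales (use gj_integral_constant nR in metis)
  show ?thesis
  proof (intro conjI allI impI)
    fix A assume "is_arc q A"
    then obtain s t where arc: "s < t" "s \<in> R" "t \<in> R" "R \<inter> {s<..<t} = {}" "A = q ` {s..t}"
      by (auto simp: is_arc_def)
    show "focal_point \<in> A"
    proof (cases "ang_mom (q \<tau>) (v \<tau>) = 0")
      case True
      then show ?thesis
        unfolding arc(5) using vertical_arc_contains_focal_point[OF arc(1-3) arc0 F0]
          ang_mom_zero_iff[OF nR] by blast
    next
      case False
      then show ?thesis
        unfolding arc(5) using curved_arc_contains_focal_point[OF arc(1-4)]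
          ang_mom_zero_iff[OF nR] by blast
    qed
  qed (simp add: converges_to_vertical_axis_def converges_to_axis)
qed

end
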